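(* Let $E$ be a strongly truncated Riesz space. Then its spectrum $\eta E$ is locally compact.
   Context: A Riesz space is a real vector lattice, with positive cone $E^{+}$. A truncation on a Riesz space $E$ is a unary operation $\ast:E^{+}\to E^{+}$, $f\mapsto f^{\ast}$, such that $f^{\ast}\wedge g=f\wedge g^{\ast}$ for all $f,g\in E^{+}$; a Riesz space with a truncation is called a truncated Riesz space. Put $P_{\ast}(E)=\{f\in E^{+}:f^{\ast}=f\}$. The truncation is strong if for each $f\in E^{+}$ there is $\varepsilon\in(0,\infty)$ with $\varepsilon f\in P_{\ast}(E)$; a Riesz space with a strong truncation is called a strongly truncated Riesz space. The spectrum $\eta E$ is the set of all nonzero Riesz homomorphisms (linear lattice homomorphisms) $u:E\to\mathbb{R}$ such that $u(f^{\ast})=\min\{1,u(f)\}$ for all $f\in E^{+}$. It is equipped with the topology inherited from the product topology on $\mathbb{R}^{E}$. *)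

theory Defs
  imports "HOL-Analysis.Analysis"
begin

class riesz_space = ordered_real_vector + lattice

instance real :: riesz_space ..

text \<open>
  A truncation is an operation on the positive cone only. It is represented here by a function
  on the whole space whose values at non-positive arguments are irrelevant: no definition
  below depends on them.
\<close>

definition is_truncation :: "('a::riesz_space \<Rightarrow> 'a) \<Rightarrow> bool" where
  "is_truncation trunc \<longleftrightarrow>
     (\<forall>f\<ge>0. 0 \<le> trunc f) \<and>
     (\<forall>f\<ge>0. \<forall>g\<ge>0. inf (trunc f) g = inf f (trunc g))"

definition truncation_fixpoints :: "('a::riesz_space \<Rightarrow> 'a) \<Rightarrow> 'a set" where
  "truncation_fixpoints trunc = {f. 0 \<le> f \<and> trunc f = f}"

definition strong_truncation :: "('a::riesz_space \<Rightarrow> 'a) \<Rightarrow> bool" where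
  "strong_truncation trunc \<longleftrightarrow>
     is_truncation trunc \<and>
     (\<forall>f\<ge>0. \<exists>\<epsilon>>0. \<epsilon> *\<^sub>R f \<in> truncation_fixpoints trunc)"

definition riesz_hom :: "('a::riesz_space \<Rightarrow> 'b::riesz_space) \<Rightarrow> bool" where
  "riesz_hom u \<longleftrightarrow>
     linear u \<and>
     (\<forall>f g. u (sup f g) = sup (u f) (u g)) \<and>
     (\<forall>f g. u (inf f g) = inf (u f) (u g))"

definition spectrum :: "('a::riesz_space \<Rightarrow> 'a) \<Rightarrow> ('a \<Rightarrow> real) set" where
  "spectrum trunc =
     {u. riesz_hom u \<and> u \<noteq> (\<lambda>_. 0) \<and> (\<forall>f\<ge>0. u (trunc f) = min 1 (u f))}"

definition spectrum_space :: "('a::riesz_space \<Rightarrow> 'a) \<Rightarrow> ('a \<Rightarrow> real) topology" where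
  "spectrum_space trunc =
     subtopology (product_topology (\<lambda>_. euclideanreal) UNIV) (spectrum trunc)"

end

theory Submission
  imports Defs
begin

text \<open>
  The spectrum is an open subspace of a compact Hausdorff space, with at most the zero functional
  missing. Since the zero functional satisfies every condition on a point of the spectrum except
  being nonzero, adjoining it leaves a set cut out of \<open>\<real>\<^sup>E\<close> by equations between evaluations at
  points of \<open>E\<close>, hence a closed set (\<open>closed_truncation_homs\<close>). Strength of the truncation makes
  this set pointwise bounded (\<open>truncation_homs_pointwise_bounded\<close>): if \<open>\<epsilon> \<bar>f\<bar>\<close> is fixed by the
  truncation, then \<open>\<epsilon> u \<bar>f\<bar> = min 1 (\<epsilon> u \<bar>f\<bar>) \<le> 1\<close>, and so \<open>\<bar>u f\<bar> = u \<bar>f\<bar> \<le> 1 / \<epsilon>\<close>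
  simultaneously for all \<open>u\<close>. By Tychonoff's theorem the enlarged set is compact; removing one
  point from it leaves an open subspace, and open subspaces of compact Hausdorff spaces are
  locally compact.
\<close>

text \<open>
  The zero functional is admitted on purpose: being nonzero is not a closed condition, and
  a net of functionals in the spectrum may converge pointwise to zero.
\<close>

definition truncation_homs :: "('a::riesz_space \<Rightarrow> 'a) \<Rightarrow> ('a \<Rightarrow> real) set" where
  "truncation_homs trunc = {u. riesz_hom u \<and> (\<forall>f\<ge>0. u (trunc f) = min 1 (u f))}"

lemma spectrum_eq_truncation_homs_minus_zero:
  "spectrum trunc = truncation_homs trunc - {\<lambda>_. 0}"
  by (auto simp: spectrum_def truncation_homs_def)

text \<open>
  Each condition, at fixed arguments, equates two continuous functions of finitely many
  coordinates of \<open>u\<close>.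
\<close>

lemma closed_truncation_homs: "closed (truncation_homs trunc)"
proof -
  have "truncation_homs trunc =
    {u. (\<forall>f g. u (f + g) = u f + u g) \<and> (\<forall>c f. u (c *\<^sub>R f) = c * u f) \<and>
        (\<forall>f g. u (sup f g) = max (u f) (u g)) \<and> (\<forall>f g. u (inf f g) = min (u f) (u g)) \<and>
        (\<forall>f. 0 \<le> f \<longrightarrow> u (trunc f) = min 1 (u f))}"
    by (auto simp: truncation_homs_def riesz_hom_def linear_iff sup_max inf_min)
  also have "closed \<dots>"
    by (intro closed_Collect_conj closed_Collect_all closed_Collect_imp open_Collect_const
        closed_Collect_eq continuous_on_add continuous_on_mult continuous_on_max
        continuous_on_min continuous_on_const continuous_on_product_coordinates)
  finally show ?thesis .
qed

text \<open>
  Strength enters only through this estimate. The bound must not depend on \<open>u\<close>, so that all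
  functionals at once lie in a product of compact intervals.
\<close>

lemma truncation_homs_pointwise_bounded:
  assumes "strong_truncation trunc"
  shows "\<exists>M. \<forall>u\<in>truncation_homs trunc. \<bar>u f\<bar> \<le> M"
proof -
  \<comment> \<open>The absolute value of \<open>f\<close>. It is positive because it dominates both \<open>f\<close> and \<open>- f\<close>, whose
    sum is zero.\<close>
  let ?a = "sup f (- f)"
  have nonneg: "0 \<le> ?a"
  proof -
    have "f \<le> ?a" "- f \<le> ?a" by simp_all
    then have "f + - f \<le> ?a + ?a" by (rule add_mono)
    then have double: "0 \<le> 2 *\<^sub>R ?a" by (simp add: scaleR_2)
    have "0 \<le> (1/2) *\<^sub>R (2 *\<^sub>R ?a)"
      by (rule scaleR_nonneg_nonneg[OF _ double]) simp
    then show ?thesis by simp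
  qed
  have "\<exists>\<epsilon>>0. \<epsilon> *\<^sub>R ?a \<in> truncation_fixpoints trunc"
    using assms nonneg unfolding strong_truncation_def by simp
  then obtain \<epsilon> where \<epsilon>: "\<epsilon> > 0"
    and fixed: "0 \<le> \<epsilon> *\<^sub>R ?a" "trunc (\<epsilon> *\<^sub>R ?a) = \<epsilon> *\<^sub>R ?a"
    by (auto simp: truncation_fixpoints_def)
  have "\<bar>u f\<bar> \<le> 1 / \<epsilon>" if u: "u \<in> truncation_homs trunc" for u
  proof -
    have lin: "linear u" and sup: "u ?a = sup (u f) (u (- f))"
      using u by (auto simp: truncation_homs_def riesz_hom_def)
    have abs: "u ?a = \<bar>u f\<bar>"
      by (simp add: sup sup_max linear_neg[OF lin] abs_real_def)
    have "u (trunc (\<epsilon> *\<^sub>R ?a)) = min 1 (u (\<epsilon> *\<^sub>R ?a))"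
      using u fixed(1) by (simp add: truncation_homs_def)
    then have "u (\<epsilon> *\<^sub>R ?a) \<le> 1"
      by (simp add: fixed(2))
    then have "\<epsilon> * \<bar>u f\<bar> \<le> 1"
      by (simp add: linear_scale[OF lin] abs)
    with \<epsilon> show ?thesis
      by (simp add: field_simps)
  qed
  then show ?thesis by (intro exI ballI)
qed

text \<open>
  Tychonoff's theorem for the box of the pointwise bounds.
\<close>

lemma compactin_truncation_homs:
  assumes "strong_truncation trunc"
  shows "compactin (product_topology (\<lambda>_. euclideanreal) UNIV) (truncation_homs trunc)"
proof -
  have "\<forall>f. \<exists>M. \<forall>u\<in>truncation_homs trunc. \<bar>u f\<bar> \<le> M"
    by (intro allI truncation_homs_pointwise_bounded assms)
  from choice[OF this]
  obtain M where M: "\<forall>f. \<forall>u\<in>truncation_homs trunc. \<bar>u f\<bar> \<le> M f" ..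
  let ?box = "PiE UNIV (\<lambda>f. {- M f..M f})"
  show ?thesis
  proof (rule closed_compactin)
    show "compactin (product_topology (\<lambda>_. euclideanreal) UNIV) ?box"
      by (simp add: compactin_PiE)
    show "truncation_homs trunc \<subseteq> ?box"
    proof
      fix u assume "u \<in> truncation_homs trunc"
      with M have "\<bar>u f\<bar> \<le> M f" for f by simp
      then have "- M f \<le> u f \<and> u f \<le> M f" for f
        by (smt (verit))
      then show "u \<in> ?box" by auto
    qed
    show "closedin (product_topology (\<lambda>_. euclideanreal) UNIV) (truncation_homs trunc)"
      using closed_truncation_homs by (simp add: euclidean_product_topology)
  qed
qed

theorem lemma3p1:
  fixes trunc :: "'a::riesz_space \<Rightarrow> 'a"
  assumes "strong_truncation trunc"
  shows "locally_compact_space (spectrum_space trunc)"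
proof -
  let ?R = "product_topology (\<lambda>_::'a. euclideanreal) UNIV"
  let ?H = "truncation_homs trunc"
  have "compact_space (subtopology ?R ?H)"
    using compactin_truncation_homs[OF assms] by (rule compact_space_subtopology)
  then have lc: "locally_compact_space (subtopology ?R ?H)"
    by (rule compact_imp_locally_compact_space)
  have hd: "Hausdorff_space (subtopology ?R ?H)"
    by (simp add: Hausdorff_space_subtopology Hausdorff_space_product_topology)
  have "closedin ?R {\<lambda>_. 0}"
    by (simp add: closedin_Hausdorff_sing_eq Hausdorff_space_product_topology)
  then have "openin ?R (- {\<lambda>_. 0})"
    by (simp add: closedin_def Compl_eq_Diff_UNIV)
  then have "openin (subtopology ?R ?H) (?H \<inter> - {\<lambda>_. 0})"
    by (rule openin_subtopology_Int2)
  then have "locally_compact_space (subtopology (subtopology ?R ?H) (?H \<inter> - {\<lambda>_. 0}))"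
    by (rule locally_compact_space_open_subset[OF disjI1[OF hd] lc])
  then show ?thesis
    by (simp add: spectrum_space_def spectrum_eq_truncation_homs_minus_zero
        subtopology_subtopology Diff_eq)
qed

end
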